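(* Let $\mathcal{T}_n^+$ denote $\mathcal{T}_n$ together with (all translates of) the $2\times 2$ square. A $p\times q$ rectangle admits a signed tiling by $\mathcal{T}_4^+$ if and only if both $p$ and $q$ are even. For $n\ge 6$ even, a $p\times q$ rectangle admits a signed tiling by $\mathcal{T}_n^+$ if and only if either both $p,q$ are even, or one of $p,q$ is odd and the other is divisible by $n\left(\frac{n}{2}-2\right)$.
   Context: Identify the unit cell $[a,a+1]\times[b,b+1]$ with $(a,b)\in\mathbb{Z}^2$. For $n$ even, $\mathcal{T}_n$ consists of all integer translates of the four polyominoes with cell sets $\{(0,j):0\le j\le n-2\}\cup\{(1,0)\}$, $\{(1,j):0\le j\le n-2\}\cup\{(0,n-2)\}$, $\{(i,0):0\le i\le n-2\}\cup\{(0,1)\}$, $\{(i,1):0\le i\le n-2\}\cup\{(n-2,0)\}$ (translations only). A signed tiling of a region $R$ (finite set of cells) is a finite collection of translated tiles with weights $\pm1$ such that the weights of tiles covering each cell sum to $1$ for cells in $R$ and to $0$ for cells outside $R$. *)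

theory Defs
  imports Main "HOL-Library.Multiset"
begin

text \<open>The pair \<open>(a, b)\<close> stands for the unit square with lower left corner \<open>(a, b)\<close>.\<close>

type_synonym cell = "int \<times> int"

definition translate :: "cell \<Rightarrow> cell set \<Rightarrow> cell set" where
  "translate v S = (\<lambda>(i, j). (i + fst v, j + snd v)) ` S"

definition translates :: "cell set set \<Rightarrow> cell set set" where
  "translates P = {translate v S | v S. S \<in> P}"

definition L1 :: "nat \<Rightarrow> cell set" where
  "L1 n = {(0, j) | j. 0 \<le> j \<and> j \<le> int n - 2} \<union> {(1, 0)}"

definition L2 :: "nat \<Rightarrow> cell set" where
  "L2 n = {(1, j) | j. 0 \<le> j \<and> j \<le> int n - 2} \<union> {(0, int n - 2)}"

definition L3 :: "nat \<Rightarrow> cell set" where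
  "L3 n = {(i, 0) | i. 0 \<le> i \<and> i \<le> int n - 2} \<union> {(0, 1)}"

definition L4 :: "nat \<Rightarrow> cell set" where
  "L4 n = {(i, 1) | i. 0 \<le> i \<and> i \<le> int n - 2} \<union> {(int n - 2, 0)}"

definition rectangle :: "cell \<Rightarrow> nat \<Rightarrow> nat \<Rightarrow> cell set" where
  "rectangle c p q = {fst c..<fst c + int p} \<times> {snd c..<snd c + int q}"

definition tile_set :: "nat \<Rightarrow> cell set set" where
  "tile_set n = translates {L1 n, L2 n, L3 n, L4 n}"

definition tile_set_plus :: "nat \<Rightarrow> cell set set" where
  "tile_set_plus n = tile_set n \<union> translates {rectangle (0, 0) 2 2}"

text \<open>A signed tiling is a finite multiset of weighted tiles: the same tile may be used
  several times, with equal or opposite weights.\<close>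

definition signed_tiling :: "cell set set \<Rightarrow> cell set \<Rightarrow> (cell set \<times> int) multiset \<Rightarrow> bool" where
  "signed_tiling \<T> R W \<longleftrightarrow>
     (\<forall>(t, w) \<in> set_mset W. t \<in> \<T> \<and> w \<in> {1, -1}) \<and>
     (\<forall>c. (\<Sum>(t, w) \<in># W. if c \<in> t then w else 0) = (if c \<in> R then 1 else 0))"

definition admits_signed_tiling :: "cell set \<Rightarrow> cell set set \<Rightarrow> bool" where
  "admits_signed_tiling R \<T> \<longleftrightarrow> (\<exists>W. signed_tiling \<T> R W)"

end

theory Submission
  imports Defs "HOL-Library.Function_Algebras"
begin

text \<open>Write \<open>n = 2m\<close> and let cells \<open>(a, b)\<close> be monomials \<open>x\<^sup>ay\<^sup>b\<close>. Modulo the tiles, \<open>u = 1 + x\<close> and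
  \<open>v = 1 + y\<close> satisfy \<open>u\<^sup>2 = v\<^sup>2 = uv = 0\<close>, \<open>u = (m - 1)v\<close> and \<open>v = (m - 1)u\<close>, so the
  quotient of the Laurent polynomial ring by the tiles is \<open>\<int> \<oplus> (\<int>/m(m - 2))v\<close>, and
  \<open>x\<^sup>ay\<^sup>b = (-1)\<^bsup>a + b\<^esup>(1 - au - bv)\<close>. A \<open>p \<times> q\<close> rectangle vanishes there if \<open>p, q\<close> are even,
  has constant term \<open>\<plusminus>1\<close> if both are odd, and equals \<open>\<plusminus>(q/2)v\<close> (or \<open>\<plusminus>(p/2)u\<close>) if only \<open>q\<close>
  (or only \<open>p\<close>) is even.\<close>

section \<open>Sums over tiles\<close>

lemma translate_iff: "(x, y) \<in> translate (a, b) S \<longleftrightarrow> (x - a, y - b) \<in> S"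
  by (force simp: translate_def)

lemma image_column: "(\<lambda>j. (a, b + int j)) ` {..<k} = {a} \<times> {b..<b + int k}"
proof (rule set_eqI, safe)
  fix y assume "y \<in> {b..<b + int k}"
  then show "(a, y) \<in> (\<lambda>j. (a, b + int j)) ` {..<k}"
    by (intro image_eqI[of _ _ "nat (y - b)"]) auto
qed auto

lemma image_row: "(\<lambda>i. (a + int i, b)) ` {..<k} = {a..<a + int k} \<times> {b}"
proof (rule set_eqI, safe)
  fix x assume "x \<in> {a..<a + int k}"
  then show "(x, b) \<in> (\<lambda>i. (a + int i, b)) ` {..<k}"
    by (intro image_eqI[of _ _ "nat (x - a)"]) auto
qed auto

text \<open>The bar is written as an image of \<open>{..<n - 1}\<close>, so that sums over a tile
  become sums over naturals plus one term for the cell beside the bar.\<close>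

lemma translate_L1:
  assumes "n \<ge> 2"
  shows "translate (a, b) (L1 n) = insert (a + 1, b) ((\<lambda>j. (a, b + int j)) ` {..<n - 1})"
  using assms unfolding image_column by (auto simp: translate_iff L1_def of_nat_diff)

lemma translate_L2:
  assumes "n \<ge> 2"
  shows "translate (a, b) (L2 n) = insert (a, b + int n - 2) ((\<lambda>j. (a + 1, b + int j)) ` {..<n - 1})"
  using assms unfolding image_column by (auto simp: translate_iff L2_def of_nat_diff)

lemma translate_L3:
  assumes "n \<ge> 2"
  shows "translate (a, b) (L3 n) = insert (a, b + 1) ((\<lambda>i. (a + int i, b)) ` {..<n - 1})"
  using assms unfolding image_row by (auto simp: translate_iff L3_def of_nat_diff)

lemma translate_L4:
  assumes "n \<ge> 2"
  shows "translate (a, b) (L4 n) = insert (a + int n - 2, b) ((\<lambda>i. (a + int i, b + 1)) ` {..<n - 1})"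
  using assms unfolding image_row by (auto simp: translate_iff L4_def of_nat_diff)

lemma translate_square:
  "translate (a, b) (rectangle (0, 0) 2 2) = {(a, b), (a + 1, b), (a, b + 1), (a + 1, b + 1)}"
  by (auto simp: translate_iff rectangle_def)

lemma rectangle_eq_image:
  "rectangle (a, b) p q = (\<lambda>(i, j). (a + int i, b + int j)) ` ({..<p} \<times> {..<q})"
proof (rule set_eqI, safe)
  fix x y assume "(x, y) \<in> rectangle (a, b) p q"
  then show "(x, y) \<in> (\<lambda>(i, j). (a + int i, b + int j)) ` ({..<p} \<times> {..<q})"
    by (intro image_eqI[of _ _ "(nat (x - a), nat (y - b))"]) (auto simp: rectangle_def)
qed (auto simp: rectangle_def)

lemma sum_translate_L1:
  assumes "n \<ge> 2"
  shows "sum f (translate (a, b) (L1 n)) = (\<Sum>j<n - 1. f (a, b + int j)) + f (a + 1, b)"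
  unfolding translate_L1[OF assms]
  by (subst sum.insert) (auto simp: sum.reindex inj_on_def add.commute)

lemma sum_translate_L2:
  assumes "n \<ge> 2"
  shows "sum f (translate (a, b) (L2 n)) =
    (\<Sum>j<n - 1. f (a + 1, b + int j)) + f (a, b + int n - 2)"
  unfolding translate_L2[OF assms]
  by (subst sum.insert) (auto simp: sum.reindex inj_on_def add.commute)

lemma sum_translate_L3:
  assumes "n \<ge> 2"
  shows "sum f (translate (a, b) (L3 n)) = (\<Sum>i<n - 1. f (a + int i, b)) + f (a, b + 1)"
  unfolding translate_L3[OF assms]
  by (subst sum.insert) (auto simp: sum.reindex inj_on_def add.commute)

lemma sum_translate_L4:
  assumes "n \<ge> 2"
  shows "sum f (translate (a, b) (L4 n)) =
    (\<Sum>i<n - 1. f (a + int i, b + 1)) + f (a + int n - 2, b)"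
  unfolding translate_L4[OF assms]
  by (subst sum.insert) (auto simp: sum.reindex inj_on_def add.commute)

lemma sum_translate_square:
  "sum f (translate (a, b) (rectangle (0, 0) 2 2)) =
    f (a, b) + f (a + 1, b) + f (a, b + 1) + f (a + 1, b + 1)"
  unfolding translate_square by (simp add: add.assoc)

lemma sum_rectangle:
  "sum f (rectangle (a, b) p q) = (\<Sum>i<p. \<Sum>j<q. f (a + int i, b + int j))"
  unfolding rectangle_eq_image
  by (subst sum.reindex) (auto simp: inj_on_def sum.cartesian_product intro!: sum.cong)

lemma finite_rectangle: "finite (rectangle c p q)"
  by (cases c) (simp add: rectangle_eq_image)

lemma tile_set_plus_eq:
  "tile_set_plus n =
    {translate v S | v S. S \<in> {L1 n, L2 n, L3 n, L4 n, rectangle (0, 0) 2 2}}"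
  unfolding tile_set_plus_def tile_set_def translates_def by blast

lemma tile_set_plusE:
  assumes "t \<in> tile_set_plus n"
  obtains a b where "t = translate (a, b) (L1 n)" | a b where "t = translate (a, b) (L2 n)"
    | a b where "t = translate (a, b) (L3 n)" | a b where "t = translate (a, b) (L4 n)"
    | a b where "t = translate (a, b) (rectangle (0, 0) 2 2)"
  using assms unfolding tile_set_plus_eq by auto

lemma finite_tile:
  assumes "n \<ge> 2" and "t \<in> tile_set_plus n"
  shows "finite t"
  using assms(2)
  by (cases rule: tile_set_plusE)
    (simp_all add: translate_L1 translate_L2 translate_L3 translate_L4 translate_square assms(1))

section \<open>Necessity\<close>

text \<open>Multiplying the covering condition at each cell \<open>c\<close> by
  \<open>\<phi> c\<close> and exchanging summations expresses the sum over \<open>R\<close> as an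
  integer combination of sums over tiles. Weights \<open>\<phi>\<close> with tile sums divisible by
  \<open>d\<close> therefore obstruct tilings.\<close>

lemma signed_tiling_dvd_sum:
  fixes \<phi> :: "cell \<Rightarrow> int"
  assumes W: "signed_tiling \<T> R W" and "finite R"
    and tiles: "\<And>t. t \<in> \<T> \<Longrightarrow> finite t \<and> d dvd sum \<phi> t"
  shows "d dvd sum \<phi> R"
proof -
  have T: "t \<in> \<T>" if "(t, w) \<in># W" for t w
    using W that unfolding signed_tiling_def by blast
  define D where "D = R \<union> (\<Union>(t, w) \<in> set_mset W. t)"
  have "finite D"
    unfolding D_def using \<open>finite R\<close> T tiles by auto
  \<comment> \<open>The induction runs over submultisets \<open>M\<close> of \<open>W\<close>, so
    that the fixed finite set \<open>D\<close> contains every tile met.\<close>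
  have exchange: "(\<Sum>c\<in>D. \<phi> c * (\<Sum>(t, w)\<in>#M. if c \<in> t then w else 0)) =
      (\<Sum>(t, w)\<in>#M. w * sum \<phi> t)" if "M \<subseteq># W" for M
    using that
  proof (induction M)
    case (add x M)
    obtain t w where x: "x = (t, w)" by force
    have "x \<in># W" using add.prems by (simp add: insert_subset_eq_iff)
    then have "t \<subseteq> D" unfolding D_def x by blast
    have "(\<Sum>c\<in>D. \<phi> c * (if c \<in> t then w else 0)) = (\<Sum>c\<in>t. \<phi> c * w)"
      using \<open>finite D\<close> \<open>t \<subseteq> D\<close> by (intro sum.mono_neutral_cong_right) auto
    moreover have "M \<subseteq># W"
      using add.prems by (meson mset_subset_eq_insertD subset_mset.less_imp_le)
    ultimately show ?case
      using add.IH by (simp add: x distrib_left sum.distrib sum_distrib_left mult.commute)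
  qed simp
  have "sum \<phi> R = (\<Sum>c\<in>D. \<phi> c * (if c \<in> R then 1 else 0))"
    using \<open>finite D\<close> by (intro sum.mono_neutral_cong_left) (auto simp: D_def)
  also have "\<dots> = (\<Sum>(t, w)\<in>#W. w * sum \<phi> t)"
    using exchange[of W] W unfolding signed_tiling_def by simp
  finally have eq: "sum \<phi> R = (\<Sum>(t, w)\<in>#W. w * sum \<phi> t)" .
  have "d dvd (\<Sum>(t, w)\<in>#M. w * sum \<phi> t)" if "M \<subseteq># W" for M
    using that
  proof (induction M)
    case (add x M)
    obtain t w where x: "x = (t, w)" by force
    have "x \<in># W" using add.prems by (simp add: insert_subset_eq_iff)
    then have "d dvd sum \<phi> t" using T tiles x by blast
    moreover have "M \<subseteq># W"
      using add.prems by (meson mset_subset_eq_insertD subset_mset.less_imp_le)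
    ultimately show ?case using add.IH by (simp add: x)
  qed simp
  then show ?thesis using eq by simp
qed

section \<open>Two weightings of the cells and their sums over tiles and rectangles\<close>

definition checker :: "cell \<Rightarrow> int" where
  "checker c = (if even (fst c + snd c) then 1 else - 1)"

text \<open>Minus the coefficient of \<open>v\<close> in \<open>x\<^sup>ay\<^sup>b\<close>.\<close>

definition slope :: "int \<Rightarrow> cell \<Rightarrow> int" where
  "slope m c = checker c * ((m - 1) * fst c + snd c)"

lemma checker_shift_right: "checker (a + int i, b) = checker (a, b) * (-1) ^ i"
  by (cases "even i") (auto simp: checker_def)

lemma checker_shift_up: "checker (a, b + int j) = checker (a, b) * (-1) ^ j"
  by (cases "even j") (auto simp: checker_def)

lemmas checker_shift = checker_shift_right checker_shift_up

lemma checker_Suc: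
  "checker (a + 1, b) = - checker (a, b)" "checker (a, b + 1) = - checker (a, b)"
  by (simp_all add: checker_def)

lemma alternating_sum:
  "(\<Sum>i<2 * k. (-1 :: int) ^ i) = 0" "(\<Sum>i<Suc (2 * k). (-1 :: int) ^ i) = 1"
  by (induction k) simp_all

lemma alternating_weighted_sum:
  "(\<Sum>i<2 * k. (-1 :: int) ^ i * int i) = - int k"
  "(\<Sum>i<Suc (2 * k). (-1 :: int) ^ i * int i) = int k"
  by (induction k) simp_all

lemma checker_column:
  "(\<Sum>j<k. checker (a, b + int j)) = checker (a, b) * (\<Sum>j<k. (-1) ^ j)"
  by (simp add: checker_shift sum_distrib_left)

lemma checker_row:
  "(\<Sum>i<k. checker (a + int i, b)) = checker (a, b) * (\<Sum>i<k. (-1) ^ i)"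
  by (simp add: checker_shift sum_distrib_left)

text \<open>\<open>slope\<close> is a sign times an affine function: \<open>j\<close> steps up
  multiply the sign by \<open>(-1) ^ j\<close> and add \<open>j\<close> to the affine part.\<close>

lemma slope_column:
  "(\<Sum>j<k. slope m (a, b + int j)) =
    slope m (a, b) * (\<Sum>j<k. (-1) ^ j) + checker (a, b) * (\<Sum>j<k. (-1) ^ j * int j)"
  by (simp add: slope_def checker_shift sum_distrib_left algebra_simps flip: sum.distrib)

lemma slope_row:
  "(\<Sum>i<k. slope m (a + int i, b)) =
    slope m (a, b) * (\<Sum>i<k. (-1) ^ i) + (m - 1) * checker (a, b) * (\<Sum>i<k. (-1) ^ i * int i)"
  by (simp add: slope_def checker_shift sum_distrib_left algebra_simps flip: sum.distrib)

lemma even_minus_1_eq_Suc: "m \<ge> 1 \<Longrightarrow> 2 * m - 1 = Suc (2 * (m - 1))" for m :: nat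
  by simp

text \<open>A bar has odd length, so its alternating signs leave the sign of its first cell, and the
  extra cell has the opposite sign.\<close>

lemma checker_tile:
  assumes "m \<ge> 2" and "t \<in> tile_set_plus (2 * m)"
  shows "sum checker t = 0"
proof -
  have n: "2 * m \<ge> 2" "m \<ge> 1" using assms(1) by simp_all
  show ?thesis
    using assms(2)
  proof (cases rule: tile_set_plusE)
    case (1 a b)
    then show ?thesis
      by (simp only: sum_translate_L1[OF n(1)] even_minus_1_eq_Suc[OF n(2)] checker_column
          alternating_sum, simp only: checker_Suc)
  next
    case (2 a b)
    have "checker (a, b + int (2 * m) - 2) = checker (a, b)" by (simp add: checker_def)
    then show ?thesis
      by (simp only: 2 sum_translate_L2[OF n(1)] even_minus_1_eq_Suc[OF n(2)] checker_column
          alternating_sum, simp only: checker_Suc)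
  next
    case (3 a b)
    then show ?thesis
      by (simp only: sum_translate_L3[OF n(1)] even_minus_1_eq_Suc[OF n(2)] checker_row
          alternating_sum, simp only: checker_Suc)
  next
    case (4 a b)
    have "checker (a + int (2 * m) - 2, b) = checker (a, b)" by (simp add: checker_def)
    then show ?thesis
      by (simp only: 4 sum_translate_L4[OF n(1)] even_minus_1_eq_Suc[OF n(2)] checker_row
          alternating_sum, simp only: checker_Suc)
  next
    case (5 a b)
    then show ?thesis
      by (simp add: sum_translate_square checker_def)
  qed
qed

text \<open>The factor \<open>m - 1\<close> on the horizontal coordinate makes the vertical tiles
  sum to zero. The horizontal tiles then give \<open>(m - 1)^2 - 1 = m(m - 2)\<close> up to
  sign.\<close>

lemma slope_tile:
  assumes "m \<ge> 2" and "t \<in> tile_set_plus (2 * m)"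
  shows "int m * (int m - 2) dvd sum (slope (int m)) t"
proof -
  have n: "2 * m \<ge> 2" "m \<ge> 1" using assms(1) by simp_all
  have m1: "int (m - 1) = int m - 1" using n(2) by simp
  show ?thesis
    using assms(2)
  proof (cases rule: tile_set_plusE)
    case (1 a b)
    have "sum (slope (int m)) t = 0"
      unfolding 1
      by (simp only: sum_translate_L1[OF n(1)] even_minus_1_eq_Suc[OF n(2)] slope_column
          alternating_sum alternating_weighted_sum m1,
          simp only: slope_def checker_Suc fst_conv snd_conv) (simp add: algebra_simps)
    then show ?thesis by simp
  next
    case (2 a b)
    have "checker (a, b + int (2 * m) - 2) = checker (a, b)" by (simp add: checker_def)
    then have "sum (slope (int m)) t = 0"
      unfolding 2
      by (simp only: sum_translate_L2[OF n(1)] even_minus_1_eq_Suc[OF n(2)] slope_column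
          alternating_sum alternating_weighted_sum m1,
          simp only: slope_def checker_Suc fst_conv snd_conv) (simp add: algebra_simps)
    then show ?thesis by simp
  next
    case (3 a b)
    have "sum (slope (int m)) t = checker (a, b) * (int m * (int m - 2))"
      unfolding 3
      by (simp only: sum_translate_L3[OF n(1)] even_minus_1_eq_Suc[OF n(2)] slope_row
          alternating_sum alternating_weighted_sum m1,
          simp only: slope_def checker_Suc fst_conv snd_conv) (simp add: algebra_simps)
    then show ?thesis by simp
  next
    case (4 a b)
    have "checker (a + int (2 * m) - 2, b) = checker (a, b)" by (simp add: checker_def)
    then have "sum (slope (int m)) t = checker (a, b) * (int m * (int m - 2))"
      unfolding 4
      by (simp only: sum_translate_L4[OF n(1)] even_minus_1_eq_Suc[OF n(2)] slope_row
          alternating_sum alternating_weighted_sum m1,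
          simp only: slope_def checker_Suc fst_conv snd_conv) (simp add: algebra_simps)
    then show ?thesis by simp
  next
    case (5 a b)
    have "sum (slope (int m)) t = 0"
      unfolding 5
      by (simp only: sum_translate_square slope_def checker_Suc fst_conv snd_conv)
        (simp add: algebra_simps)
    then show ?thesis by simp
  qed
qed

lemma checker_rectangle:
  "sum checker (rectangle (a, b) p q) =
    checker (a, b) * (\<Sum>i<p. (-1) ^ i) * (\<Sum>j<q. (-1) ^ j)"
  by (simp add: sum_rectangle checker_column checker_row flip: sum_distrib_right)

lemma slope_rectangle:
  "sum (slope m) (rectangle (a, b) p q) =
    slope m (a, b) * (\<Sum>i<p. (-1) ^ i) * (\<Sum>j<q. (-1) ^ j)
    + (m - 1) * checker (a, b) * (\<Sum>i<p. (-1) ^ i * int i) * (\<Sum>j<q. (-1) ^ j)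
    + checker (a, b) * (\<Sum>i<p. (-1) ^ i) * (\<Sum>j<q. (-1) ^ j * int j)"
  by (simp add: sum_rectangle slope_column slope_row checker_row sum.distrib distrib_right
      flip: sum_distrib_right)

lemma checker_dvd_cancel: "d dvd checker c * x \<longleftrightarrow> d dvd x"
  by (simp add: checker_def)

lemma signed_tiling_rectangle_necessary:
  assumes m: "m \<ge> 2" and "admits_signed_tiling (rectangle c p q) (tile_set_plus (2 * m))"
  shows "(even p \<and> even q) \<or> (odd p \<and> 2 * m * (m - 2) dvd q) \<or> (odd q \<and> 2 * m * (m - 2) dvd p)"
proof -
  obtain a b where c: "c = (a, b)" by force
  obtain W where W: "signed_tiling (tile_set_plus (2 * m)) (rectangle (a, b) p q) W"
    using assms(2) unfolding admits_signed_tiling_def c by blast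
  let ?N = "int m * (int m - 2)"
  have fin: "finite t" if "t \<in> tile_set_plus (2 * m)" for t
    using finite_tile[of "2 * m"] that m by simp
  \<comment> \<open>Divisibility by \<open>0\<close> means being zero, so one lemma serves both
    weightings.\<close>
  have "0 dvd sum checker (rectangle (a, b) p q)"
    using checker_tile[OF m] fin by (intro signed_tiling_dvd_sum[OF W finite_rectangle]) simp
  then have checker0: "sum checker (rectangle (a, b) p q) = 0" by simp
  have slope0: "?N dvd sum (slope (int m)) (rectangle (a, b) p q)"
    using slope_tile[OF m] fin by (intro signed_tiling_dvd_sum[OF W finite_rectangle]) simp
  \<comment> \<open>\<open>slope\<close> only detects half of the even side; doubling gives the
    stated modulus.\<close>
  have nat_dvd: "2 * m * (m - 2) dvd 2 * k" if "?N dvd int k" for k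
  proof -
    have "int (m * (m - 2)) dvd int k" using that m by (simp add: of_nat_diff)
    then have "m * (m - 2) dvd k" by (simp only: int_dvd_int_iff)
    then show ?thesis by (simp add: mult.assoc)
  qed
  consider "even p" "even q" | "odd p" "odd q" | "odd p" "even q" | "even p" "odd q" by blast
  then show ?thesis
  proof cases
    case 2
    then obtain k l where kl: "p = Suc (2 * k)" "q = Suc (2 * l)" by (metis oddE Suc_eq_plus1)
    have "sum checker (rectangle (a, b) p q) = checker (a, b)"
      unfolding kl checker_rectangle by (simp only: alternating_sum mult_1_right)
    with checker0 show ?thesis by (simp add: checker_def split: if_splits)
  next
    case 3
    then obtain k l where kl: "p = Suc (2 * k)" "q = 2 * l" by (metis oddE evenE Suc_eq_plus1)
    \<comment> \<open>The plain alternating sum along the even side vanishes, so only the term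
      weighted along that side survives.\<close>
    have "sum (slope (int m)) (rectangle (a, b) p q) = checker (a, b) * - int l"
      unfolding kl slope_rectangle
      by (simp only: alternating_sum alternating_weighted_sum)
    with slope0 have "?N dvd int l" by (simp only: checker_dvd_cancel dvd_minus_iff)
    then show ?thesis using nat_dvd 3 kl by blast
  next
    case 4
    then obtain k l where kl: "p = 2 * k" "q = Suc (2 * l)" by (metis oddE evenE Suc_eq_plus1)
    have "sum (slope (int m)) (rectangle (a, b) p q) = checker (a, b) * - ((int m - 1) * int k)"
      unfolding kl slope_rectangle
      by (simp only: alternating_sum alternating_weighted_sum) simp
    with slope0 have "?N dvd (int m - 1) * int k"
      by (simp only: checker_dvd_cancel dvd_minus_iff)
    \<comment> \<open>Since \<open>(m - 1)^2 = ?N + 1\<close>, the factor \<open>m - 1\<close> is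
      its own inverse modulo \<open>?N\<close>; multiplying by it once more cancels it.\<close>
    then have "?N dvd (int m - 1) * ((int m - 1) * int k) - ?N * int k"
      by (intro dvd_diff dvd_triv_left) (rule dvd_mult)
    also have "(int m - 1) * ((int m - 1) * int k) - ?N * int k = int k"
      by (simp add: algebra_simps)
    finally show ?thesis using nat_dvd 4 kl by blast
  qed simp
qed

section \<open>Sufficiency\<close>

lemma sum_double: "(\<Sum>i<2 * k. f i) = (\<Sum>i<k. f (2 * i) + f (Suc (2 * i)))"
  for f :: "nat \<Rightarrow> 'a :: comm_monoid_add"
  by (induction k) (simp_all add: add.assoc)

text \<open>\<open>e a b\<close> plays the role of \<open>x\<^sup>ay\<^sup>b\<close>, and \<open>G\<close> that of the ideal generated by the tiles. The
  assumptions are invariant under \<open>e \<mapsto> (\<lambda>a b. e b a)\<close>, which gives each lemma a mirror image.\<close>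

locale tile_relations =
  fixes G :: "'g :: comm_ring_1 set" and e :: "int \<Rightarrow> int \<Rightarrow> 'g" and m :: nat
  assumes m: "m \<ge> 2"
    and zero: "0 \<in> G"
    and diff: "\<And>x y. x \<in> G \<Longrightarrow> y \<in> G \<Longrightarrow> x - y \<in> G"
    and square: "\<And>a b. e a b + e (a + 1) b + e a (b + 1) + e (a + 1) (b + 1) \<in> G"
    and L1: "\<And>a b. (\<Sum>j<2 * m - 1. e a (b + int j)) + e (a + 1) b \<in> G"
    and L2: "\<And>a b. (\<Sum>j<2 * m - 1. e (a + 1) (b + int j)) + e a (b + int (2 * m) - 2) \<in> G"
    and L3: "\<And>a b. (\<Sum>i<2 * m - 1. e (a + int i) b) + e a (b + 1) \<in> G"
    and L4: "\<And>a b. (\<Sum>i<2 * m - 1. e (a + int i) (b + 1)) + e (a + int (2 * m) - 2) b \<in> G"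
begin

text \<open>Reflection in the diagonal exchanges \<open>L1\<close> with \<open>L3\<close> and
  \<open>L2\<close> with \<open>L4\<close>.\<close>

lemma mirror: "tile_relations G (\<lambda>a b. e b a) m"
proof
  show "e b a + e b (a + 1) + e (b + 1) a + e (b + 1) (a + 1) \<in> G" for a b
    using square[of b a] by (simp add: ac_simps)
qed (use m zero diff L1 L2 L3 L4 in simp_all)

lemma add: "x \<in> G \<Longrightarrow> y \<in> G \<Longrightarrow> x + y \<in> G"
  using diff[of x "0 - y"] diff[OF zero, of y] by simp

lemma sum: "(\<And>i. i \<in> A \<Longrightarrow> f i \<in> G) \<Longrightarrow> sum f A \<in> G"
  by (induction A rule: infinite_finite_induct) (auto simp: zero add)

text \<open>\<open>G\<close> is only assumed to be closed under differences, so multiples are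
  repeated sums.\<close>

lemma of_nat_mult: "x \<in> G \<Longrightarrow> of_nat k * x \<in> G"
  by (induction k) (auto simp: zero add distrib_right)

text \<open>Vertical and horizontal dominoes, the monomial \<open>x^a y^b\<close> times
  \<open>v\<close> and times \<open>u\<close>; \<open>mirror\<close> exchanges the two.\<close>

abbreviation V where "V a b \<equiv> e a b + e a (b + 1)"

abbreviation H where "H a b \<equiv> e a b + e (a + 1) b"

text \<open>The two tiles share the same bar, so their difference leaves just the two extra
  cells.\<close>

lemma x_power_eq_y_squared: "e (a + int (2 * m) - 2) b - e a (b + 2) \<in> G"
  using diff[OF L4[of a b] L3[of a "b + 1"]] by (simp add: add.commute)

text \<open>In an \<open>L3\<close> tile, trade the last cell of the bar for
  \<open>e a (b + 2)\<close>, which joins the extra cell in a vertical domino. The other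
  \<open>2 * m - 2\<close> cells of the bar pair up.\<close>

lemma row_relation: "(\<Sum>i<m - 1. H (a + 2 * int i) b) + V a (b + 1) \<in> G"
proof -
  have "2 * m - 1 = Suc (2 * (m - 1))" using m by simp
  then have "(\<Sum>i<2 * m - 1. e (a + int i) b) =
      (\<Sum>i<m - 1. H (a + 2 * int i) b) + e (a + int (2 * (m - 1))) b"
    by (simp only: sum.lessThan_Suc sum_double) (simp add: ac_simps)
  moreover have "int (2 * (m - 1)) = int (2 * m) - 2" using m by simp
  ultimately have "(\<Sum>i<2 * m - 1. e (a + int i) b) =
      (\<Sum>i<m - 1. H (a + 2 * int i) b) + e (a + int (2 * m) - 2) b"
    by (simp only: add_diff_eq)
  then show ?thesis
    using diff[OF L3[of a b] x_power_eq_y_squared[of a b]]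
    by (simp add: algebra_simps)
qed

lemma V_step_right: "V a b + V (a + 1) b \<in> G"
  using square[of a b] by (simp add: ac_simps)

text \<open>The relation \<open>v^2 = 0\<close>: in the sum of \<open>row_relation\<close> at two
  consecutive heights, the horizontal dominoes stack into squares and drop out.\<close>

lemma V_step_up: "V a b + V a (b + 1) \<in> G"
proof -
  have "(\<Sum>i<m - 1. H (a + 2 * int i) (b - 1)) + V a b
      + ((\<Sum>i<m - 1. H (a + 2 * int i) b) + V a (b + 1)) \<in> G" (is "?x \<in> G")
    using add[OF row_relation[of a "b - 1"] row_relation[of a b]] by simp
  moreover have "H c (b - 1) + H c b \<in> G" for c
    using square[of c "b - 1"] by (simp add: ac_simps)
  then have "(\<Sum>i<m - 1. H (a + 2 * int i) (b - 1) + H (a + 2 * int i) b) \<in> G" (is "?y \<in> G")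
    by (intro sum)
  ultimately have "?x - ?y \<in> G" by (rule diff)
  then show ?thesis by (simp add: sum.distrib algebra_simps)
qed

lemma V_shift: "V a (b + 2 * int k) - V a b \<in> G"
proof (induction k)
  case (Suc k)
  let ?b = "b + 2 * int k"
  have "V a (?b + 1) + V a (?b + 2) - (V a ?b + V a (?b + 1)) \<in> G"
    using diff[OF V_step_up[of a "?b + 1"] V_step_up[of a ?b]] by (simp add: ac_simps)
  from add[OF this Suc] show ?case by (simp add: algebra_simps)
qed (simp add: zero)

lemma V_sum: "(\<Sum>k<N. V a (b + 2 * int k)) - of_nat N * V a b \<in> G"
proof -
  have "(\<Sum>k<N. V a (b + 2 * int k) - V a b) \<in> G" by (intro sum V_shift)
  then show ?thesis by (simp only: sum_subtractf sum_constant card_lessThan)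
qed

text \<open>The relation \<open>u = (m - 1)v\<close>. The mirrored \<open>row_relation\<close> has
  \<open>m - 1\<close> vertical dominoes, all congruent by \<open>V_shift\<close>, and a horizontal
  one whose shift back by one column changes the sign.\<close>

lemma V_multiple: "of_nat (m - 1) * V a b - H a b \<in> G"
proof -
  interpret mir: tile_relations G "\<lambda>a b. e b a" m by (rule mirror)
  have "(\<Sum>k<m - 1. V a (b + 2 * int k)) + H (a + 1) b \<in> G" (is "?x \<in> G")
    using mir.row_relation[where a = b and b = a] by (simp add: ac_simps)
  moreover have "H a b + H (a + 1) b \<in> G" (is "?y \<in> G")
    using mir.V_step_up[where a = b and b = a] by (simp add: ac_simps)
  ultimately have "?x - ?y - ((\<Sum>k<m - 1. V a (b + 2 * int k)) - of_nat (m - 1) * V a b) \<in> G"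
    by (intro diff V_sum)
  moreover have "?x - ?y - ((\<Sum>k<m - 1. V a (b + 2 * int k)) - of_nat (m - 1) * V a b)
      = of_nat (m - 1) * V a b - H a b"
    by (simp only: algebra_simps)
  ultimately show ?thesis by (simp only:)
qed

text \<open>Combining \<open>V_multiple\<close> with its mirror image gives
  \<open>(m - 1)^2 v = v\<close>.\<close>

lemma V_torsion: "of_nat (m * (m - 2)) * V a b \<in> G"
proof -
  interpret mir: tile_relations G "\<lambda>a b. e b a" m by (rule mirror)
  have "of_nat (m - 1) * (of_nat (m - 1) * V a b - H a b) + (of_nat (m - 1) * H a b - V a b) \<in> G"
    (is "?x \<in> G")
    using mir.V_multiple[where a = b and b = a] by (intro add of_nat_mult V_multiple)
  \<comment> \<open>Writing \<open>m\<close> as \<open>k + 2\<close> removes the truncated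
    subtractions.\<close>
  moreover obtain k where "m = k + 2" using m by (metis le_add_diff_inverse2)
  then have "?x = of_nat (m * (m - 2)) * V a b"
    by (simp add: algebra_simps)
  ultimately show ?thesis by simp
qed

text \<open>The column splits into \<open>q div 2\<close> congruent vertical dominoes, and
  \<open>q div 2\<close> is a multiple of \<open>m * (m - 2)\<close>.\<close>

lemma column:
  assumes "2 * m * (m - 2) dvd q"
  shows "(\<Sum>j<q. e a (b + int j)) \<in> G"
proof -
  obtain r where q: "q = 2 * (r * (m * (m - 2)))"
    using assms by (metis dvdE mult.assoc mult.commute)
  let ?N = "r * (m * (m - 2))"
  have "(\<Sum>j<q. e a (b + int j)) = (\<Sum>k<?N. V a (b + 2 * int k))"
    unfolding q sum_double by (simp add: ac_simps)
  moreover have "of_nat r * (of_nat (m * (m - 2)) * V a b) \<in> G"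
    by (intro of_nat_mult V_torsion)
  then have "of_nat ?N * V a b \<in> G" by (simp add: mult.assoc)
  from add[OF V_sum[of a b ?N] this] have "(\<Sum>k<?N. V a (b + 2 * int k)) \<in> G" by simp
  ultimately show ?thesis by simp
qed

lemma even_rectangle:
  assumes "even p" and "even q"
  shows "(\<Sum>i<p. \<Sum>j<q. e (a + int i) (b + int j)) \<in> G"
proof -
  obtain k l where kl: "p = 2 * k" "q = 2 * l" using assms by (elim evenE)
  have "(\<Sum>i<k. \<Sum>j<l. V (a + 2 * int i) (b + 2 * int j) + V (a + 2 * int i + 1) (b + 2 * int j)) \<in> G"
    by (intro sum V_step_right)
  then show ?thesis
    unfolding kl sum_double by (simp add: sum.distrib ac_simps)
qed

text \<open>Splitting off the last column leaves a rectangle with even sides.\<close>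

lemma odd_rectangle:
  assumes "odd p" and "2 * m * (m - 2) dvd q"
  shows "(\<Sum>i<p. \<Sum>j<q. e (a + int i) (b + int j)) \<in> G"
proof -
  obtain k where k: "p = Suc (2 * k)" using assms(1) by (metis oddE Suc_eq_plus1)
  have "even q" using assms(2) by (metis dvd_mult_left dvd_trans dvd_triv_left)
  then show ?thesis
    unfolding k sum.lessThan_Suc using assms(2) by (intro add even_rectangle column) simp_all
qed

end

section \<open>Signed coverings as a subgroup of the integer functions on cells\<close>

definition cell_indicator :: "cell set \<Rightarrow> cell \<Rightarrow> int" where
  "cell_indicator S c = (if c \<in> S then 1 else 0)"

text \<open>Allowing any target function in place of the indicator of a region makes the set closed
  under differences, as \<open>G\<close> must be.\<close>

definition signed_coverings :: "cell set set \<Rightarrow> (cell \<Rightarrow> int) set" where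
  "signed_coverings \<T> = {f. \<exists>W. (\<forall>(t, w) \<in> set_mset W. t \<in> \<T> \<and> w \<in> {1, -1}) \<and>
     (\<forall>c. (\<Sum>(t, w) \<in># W. if c \<in> t then w else 0) = f c)}"

lemma admits_signed_tiling_iff:
  "admits_signed_tiling R \<T> \<longleftrightarrow> cell_indicator R \<in> signed_coverings \<T>"
  by (simp add: admits_signed_tiling_def signed_tiling_def signed_coverings_def cell_indicator_def)

lemma signed_coverings_zero: "0 \<in> signed_coverings \<T>"
  unfolding signed_coverings_def by (auto intro!: exI[of _ "{#}"])

lemma signed_coverings_tile: "t \<in> \<T> \<Longrightarrow> cell_indicator t \<in> signed_coverings \<T>"
  unfolding signed_coverings_def
  by (auto simp: cell_indicator_def intro!: exI[of _ "{#(t, 1)#}"])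

lemma signed_coverings_diff:
  assumes "f \<in> signed_coverings \<T>" and "g \<in> signed_coverings \<T>"
  shows "f - g \<in> signed_coverings \<T>"
proof -
  obtain W where W: "\<forall>(t, w) \<in> set_mset W. t \<in> \<T> \<and> w \<in> {1, -1}"
      "\<And>c. (\<Sum>(t, w) \<in># W. if c \<in> t then w else 0) = f c"
    using assms(1) unfolding signed_coverings_def by blast
  obtain U where U: "\<forall>(t, w) \<in> set_mset U. t \<in> \<T> \<and> w \<in> {1, -1}"
      "\<And>c. (\<Sum>(t, w) \<in># U. if c \<in> t then w else 0) = g c"
    using assms(2) unfolding signed_coverings_def by blast
  \<comment> \<open>Flipping every weight realises \<open>- g\<close>.\<close>
  let ?U = "image_mset (\<lambda>(t, w). (t, - w)) U"
  have neg: "(\<Sum>(t, w) \<in># image_mset (\<lambda>(t, w). (t, - w)) M. if c \<in> t then w else 0) =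
      - (\<Sum>(t, w) \<in># M. if c \<in> t then w else 0)" for c :: cell and M :: "(cell set \<times> int) multiset"
    by (induction M) auto
  have "(\<Sum>(t, w) \<in># W + ?U. if c \<in> t then w else 0) = (f - g) c" for c
    by (simp only: image_mset_union sum_mset.union neg W(2) U(2)) simp
  moreover have "\<forall>(t, w) \<in> set_mset (W + ?U). t \<in> \<T> \<and> w \<in> {1, -1}"
    using W(1) U(1) by auto
  ultimately show ?thesis
    unfolding signed_coverings_def by blast
qed

lemma cell_indicator_eq_sum: "finite S \<Longrightarrow> cell_indicator S = (\<Sum>c\<in>S. cell_indicator {c})"
proof (induction rule: finite_induct)
  case (insert c S)
  have "cell_indicator (insert c S) = cell_indicator {c} + cell_indicator S"
    using insert.hyps by (auto simp: fun_eq_iff cell_indicator_def)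
  then show ?case
    by (subst sum.insert) (use insert in simp_all)
qed (simp add: fun_eq_iff cell_indicator_def)

text \<open>The ring is that of functions with pointwise operations, where
  \<open>of_nat k * f\<close> is the \<open>k\<close>-fold sum of \<open>f\<close>; a monomial
  becomes the indicator of one cell.\<close>

lemma tile_relations_signed_coverings:
  assumes m: "m \<ge> 2"
  shows "tile_relations (signed_coverings (tile_set_plus (2 * m))) (\<lambda>a b. cell_indicator {(a, b)}) m"
proof -
  have n: "2 * m \<ge> 2" using m by simp
  have tile: "(\<Sum>c\<in>translate (a, b) S. cell_indicator {c}) \<in> signed_coverings (tile_set_plus (2 * m))"
    if "S \<in> {L1 (2 * m), L2 (2 * m), L3 (2 * m), L4 (2 * m), rectangle (0, 0) 2 2}" for a b S
  proof -
    have "translate (a, b) S \<in> tile_set_plus (2 * m)"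
      unfolding tile_set_plus_eq using that by blast
    then show ?thesis
      using signed_coverings_tile finite_tile[OF n] cell_indicator_eq_sum by metis
  qed
  show ?thesis
    by unfold_locales
      (use m tile[of "L1 (2 * m)"] tile[of "L2 (2 * m)"] tile[of "L3 (2 * m)"]
          tile[of "L4 (2 * m)"] tile[of "rectangle (0, 0) 2 2"]
        in \<open>simp_all only:
          signed_coverings_zero signed_coverings_diff sum_translate_L1[OF n]
          sum_translate_L2[OF n] sum_translate_L3[OF n] sum_translate_L4[OF n]
          sum_translate_square insert_iff simp_thms\<close>)
qed

lemma signed_tiling_rectangle_sufficient:
  assumes "m \<ge> 2"
    and "(even p \<and> even q) \<or> (odd p \<and> 2 * m * (m - 2) dvd q) \<or> (odd q \<and> 2 * m * (m - 2) dvd p)"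
  shows "admits_signed_tiling (rectangle c p q) (tile_set_plus (2 * m))"
proof -
  obtain a b where c: "c = (a, b)" by force
  let ?e = "\<lambda>a b. cell_indicator {(a, b)}"
  interpret tile_relations "signed_coverings (tile_set_plus (2 * m))" ?e m
    using assms(1) by (rule tile_relations_signed_coverings)
  interpret mir: tile_relations "signed_coverings (tile_set_plus (2 * m))" "\<lambda>a b. ?e b a" m
    by (rule mirror)
  have "(\<Sum>i<p. \<Sum>j<q. ?e (a + int i) (b + int j)) \<in> signed_coverings (tile_set_plus (2 * m))"
    using assms(2)
  proof (elim disjE conjE)
    assume "odd q" "2 * m * (m - 2) dvd p"
    then show ?thesis
      \<comment> \<open>The mirrored lemma sums over rows first, hence the swap.\<close>
      using mir.odd_rectangle[of q p, where a = b and b = a] by (subst sum.swap) simp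
  qed (intro even_rectangle odd_rectangle; assumption)+
  then show ?thesis
    by (simp only: c admits_signed_tiling_iff cell_indicator_eq_sum[OF finite_rectangle] sum_rectangle)
qed

theorem theorem2:
  fixes p q :: nat and c :: cell
  assumes "p \<ge> 1" and "q \<ge> 1"
  shows "(admits_signed_tiling (rectangle c p q) (tile_set_plus 4) \<longleftrightarrow> even p \<and> even q) \<and>
    (\<forall>n :: nat. n \<ge> 6 \<and> even n \<longrightarrow>
      (admits_signed_tiling (rectangle c p q) (tile_set_plus n) \<longleftrightarrow>
        (even p \<and> even q) \<or>
        (odd p \<and> n * (n div 2 - 2) dvd q) \<or>
        (odd q \<and> n * (n div 2 - 2) dvd p)))"
proof -
  have iff: "admits_signed_tiling (rectangle c p q) (tile_set_plus (2 * m)) \<longleftrightarrow>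
      (even p \<and> even q) \<or> (odd p \<and> 2 * m * (m - 2) dvd q) \<or> (odd q \<and> 2 * m * (m - 2) dvd p)"
    if "m \<ge> 2" for m
    using signed_tiling_rectangle_necessary signed_tiling_rectangle_sufficient that by metis
  show ?thesis
  proof (intro conjI allI impI)
    show "admits_signed_tiling (rectangle c p q) (tile_set_plus 4) \<longleftrightarrow> even p \<and> even q"
      \<comment> \<open>For \<open>m = 2\<close> the modulus is \<open>0\<close>, which divides no
        positive side length.\<close>
      using iff[of 2] assms by simp
  next
    fix n :: nat
    assume "n \<ge> 6 \<and> even n"
    then obtain m where "n = 2 * m" "m \<ge> 2" by (auto elim!: evenE)
    then show "admits_signed_tiling (rectangle c p q) (tile_set_plus n) \<longleftrightarrow>
        (even p \<and> even q) \<or>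
        (odd p \<and> n * (n div 2 - 2) dvd q) \<or>
        (odd q \<and> n * (n div 2 - 2) dvd p)"
      using iff by simp
  qed
qed

end
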